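(* Let $R$ be a commutative ring, $M$ an $R$-module and $Y\subseteq q\mathrm{Spec}(M)$, where $q\mathrm{Spec}(M)$ carries the developed Zariski topology. (1) $Y$ is an irreducible closed subset of $q\mathrm{Spec}(M)$ if and only if $Y=D^M(L)$ for some $L\in q\mathrm{Spec}(M)$. Thus every irreducible closed subset of $q\mathrm{Spec}(M)$ has a generic point. (2) If $M$ is quasi-prime-embedding, then the correspondence $D^M(L)\mapsto L$ is a bijection of the set of irreducible components of $q\mathrm{Spec}(M)$ onto the set of minimal elements of $q\mathrm{Spec}(M)$ with respect to inclusion. (3) Let $M$ be a quasi-primeful $R$-module. Then the set of all irreducible components of $q\mathrm{Spec}(M)$ is $$T=\{D^M(IM)\mid I \text{ is a minimal element of } D^R(\mathrm{Ann}(M)) \text{ with respect to inclusion}\}.$$ (4) Let $R$ be an arithmetical Laskerian ring and $M$ be a nonzero quasi-primeful $R$-module. Then $q\mathrm{Spec}(M)$ has finitely many irreducible components.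
   Context: All rings are commutative with nonzero identity and all modules are unital. For a submodule $N$ of $M$, $(N:M)=\{r\in R\mid rM\subseteq N\}$ and $\mathrm{Ann}(M)=(\mathbf 0:M)$. A proper ideal $I$ of a ring is quasi-prime if for all ideals $A,B$, $A\cap B\subseteq I$ implies $A\subseteq I$ or $B\subseteq I$. A proper submodule $N$ of $M$ is quasi-prime if $(N:M)$ is a quasi-prime ideal. $q\mathrm{Spec}(M)$ is the set of quasi-prime submodules of $M$. For a submodule $N$ of $M$, $D^M(N)=\{L\in q\mathrm{Spec}(M)\mid (L:M)\supseteq (N:M)\}$; in particular, for an ideal $J$ of $R$, $D^R(J)$ is the set of quasi-prime ideals of $R$ containing $J$. The developed Zariski topology on $q\mathrm{Spec}(M)$ is the topology whose closed sets are exactly the sets $D^M(N)$, $N$ a submodule of $M$. The natural map is $\psi: q\mathrm{Spec}(M)\to q\mathrm{Spec}(R/\mathrm{Ann}(M))$, $\psi(L)=(L:M)/\mathrm{Ann}(M)$. $M$ is quasi-prime-embedding if $\psi$ is injective; $M$ is quasi-primeful if $M=(\mathbf 0)$, or $M\neq(\mathbf 0)$ and $\psi$ is surjective. A topological space $X$ is irreducible if $X\neq\emptyset$ and every two non-empty open subsets intersect; a subset is irreducible if it is so as a subspace; an irreducible component is a maximal irreducible subset. A generic point of a closed subset $Y$ is $y\in Y$ with $Y=Cl(\{y\})$, the closure of $\{y\}$. A ring is serial if its ideals are linearly ordered by inclusion; $R$ is arithmetical if $R_{\mathfrak p}$ is serial for every maximal ideal $\mathfrak p$. $R$ is Laskerian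 if every proper ideal of $R$ is a finite intersection of primary ideals. *)

theory Defs
  imports "HOL-Algebra.QuotRing" "HOL-Algebra.Module" "HOL-Analysis.Abstract_Topology"
begin

section \<open>Minimal elements and irreducible subsets\<close>

definition minimal_elements :: "'a set set \<Rightarrow> 'a set set" where
  "minimal_elements F = {A \<in> F. \<forall>B\<in>F. B \<subseteq> A \<longrightarrow> B = A}"

definition irreducible_space :: "'a topology \<Rightarrow> bool" where
  "irreducible_space X \<longleftrightarrow> topspace X \<noteq> {} \<and>
     (\<forall>U V. openin X U \<and> openin X V \<and> U \<noteq> {} \<and> V \<noteq> {} \<longrightarrow> U \<inter> V \<noteq> {})"

definition irreducible_subset :: "'a topology \<Rightarrow> 'a set \<Rightarrow> bool" where
  "irreducible_subset X S \<longleftrightarrow> S \<subseteq> topspace X \<and> irreducible_space (subtopology X S)"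

definition irreducible_components :: "'a topology \<Rightarrow> 'a set set" where
  "irreducible_components X =
     {C. irreducible_subset X C \<and> (\<forall>C'. irreducible_subset X C' \<and> C \<subseteq> C' \<longrightarrow> C' = C)}"

definition generic_point :: "'a topology \<Rightarrow> 'a set \<Rightarrow> 'a \<Rightarrow> bool" where
  "generic_point X Y y \<longleftrightarrow> y \<in> Y \<and> Y = Abstract_Topology.closure_of X {y}"


section \<open>Quasi-prime ideals and submodules\<close>

definition quasi_prime_ideal :: "'a set \<Rightarrow> ('a, 'c) ring_scheme \<Rightarrow> bool" where
  "quasi_prime_ideal I R \<longleftrightarrow> ideal I R \<and> I \<noteq> carrier R \<and>
     (\<forall>A B. ideal A R \<and> ideal B R \<and> A \<inter> B \<subseteq> I \<longrightarrow> A \<subseteq> I \<or> B \<subseteq> I)"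

definition colon :: "('a, 'c) ring_scheme \<Rightarrow> ('a, 'b, 'd) module_scheme \<Rightarrow> 'b set \<Rightarrow> 'a set" where
  "colon R M N = {r \<in> carrier R. \<forall>x\<in>carrier M. r \<odot>\<^bsub>M\<^esub> x \<in> N}"

definition annihilator :: "('a, 'c) ring_scheme \<Rightarrow> ('a, 'b, 'd) module_scheme \<Rightarrow> 'a set" where
  "annihilator R M = colon R M {\<zero>\<^bsub>M\<^esub>}"

definition qSpec :: "('a, 'c) ring_scheme \<Rightarrow> ('a, 'b, 'd) module_scheme \<Rightarrow> 'b set set" where
  "qSpec R M = {L. submodule L R M \<and> L \<noteq> carrier M \<and> quasi_prime_ideal (colon R M L) R}"

definition DM :: "('a, 'c) ring_scheme \<Rightarrow> ('a, 'b, 'd) module_scheme \<Rightarrow> 'b set \<Rightarrow> 'b set set" where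
  "DM R M N = {L \<in> qSpec R M. colon R M N \<subseteq> colon R M L}"

text \<open>A ring regarded as a module over itself satisfies \<open>(J : R) = J\<close> for each ideal \<open>J\<close>,
  so its quasi-prime submodules are its quasi-prime ideals. The following two sets are stated
  directly in terms of ideals.\<close>

definition ring_qSpec :: "('a, 'c) ring_scheme \<Rightarrow> 'a set set" where
  "ring_qSpec R = {I. quasi_prime_ideal I R}"

definition DR :: "('a, 'c) ring_scheme \<Rightarrow> 'a set \<Rightarrow> 'a set set" where
  "DR R J = {I \<in> ring_qSpec R. J \<subseteq> I}"

definition ideal_smult ::
    "('a, 'c) ring_scheme \<Rightarrow> ('a, 'b, 'd) module_scheme \<Rightarrow> 'a set \<Rightarrow> 'b set" where
  "ideal_smult R M I = {\<Oplus>\<^bsub>M\<^esub>k\<in>{..<n}. a k \<odot>\<^bsub>M\<^esub> x k | (n::nat) a x.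
     a \<in> {..<n} \<rightarrow> I \<and> x \<in> {..<n} \<rightarrow> carrier M}"

text \<open>\<open>(L : M)/Ann(M)\<close> is the set of cosets of \<open>Ann(M)\<close> with a representative in \<open>(L : M)\<close>.\<close>

definition natural_map ::
    "('a, 'c) ring_scheme \<Rightarrow> ('a, 'b, 'd) module_scheme \<Rightarrow> 'b set \<Rightarrow> 'a set set" where
  "natural_map R M L = (\<lambda>r. annihilator R M +>\<^bsub>R\<^esub> r) ` colon R M L"

definition quasi_prime_embedding ::
    "('a, 'c) ring_scheme \<Rightarrow> ('a, 'b, 'd) module_scheme \<Rightarrow> bool" where
  "quasi_prime_embedding R M \<longleftrightarrow> inj_on (natural_map R M) (qSpec R M)"

definition quasi_primeful ::
    "('a, 'c) ring_scheme \<Rightarrow> ('a, 'b, 'd) module_scheme \<Rightarrow> bool" where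
  "quasi_primeful R M \<longleftrightarrow> carrier M = {\<zero>\<^bsub>M\<^esub>} \<or>
     (carrier M \<noteq> {\<zero>\<^bsub>M\<^esub>} \<and>
      natural_map R M ` qSpec R M = ring_qSpec (R Quot annihilator R M))"


section \<open>The developed Zariski topology\<close>

definition dev_zariski ::
    "('a, 'c) ring_scheme \<Rightarrow> ('a, 'b, 'd) module_scheme \<Rightarrow> 'b set topology" where
  "dev_zariski R M = topology (\<lambda>U. \<exists>N. submodule N R M \<and> U = qSpec R M - DM R M N)"

lemma (in Module.module) submodule_Inter:
  assumes "F \<noteq> {}" and F: "\<And>N. N \<in> F \<Longrightarrow> submodule N R M"
  shows "submodule (\<Inter>F) R M"
proof (rule submoduleI)
  note F' = submoduleE[OF F]
  obtain N where "N \<in> F" using assms(1) by blast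
  then show "\<Inter>F \<subseteq> carrier M"
    using F'(1) by (meson Inter_lower subset_trans)
  have "\<zero>\<^bsub>M\<^esub> \<in> N" if "N \<in> F" for N
    using subgroup.one_closed[OF submodule.axioms(1)[OF F[OF that]]] by simp
  then show "\<zero>\<^bsub>M\<^esub> \<in> \<Inter>F" by simp
  show "\<ominus>\<^bsub>M\<^esub> a \<in> \<Inter>F" if "a \<in> \<Inter>F" for a
    using that F'(3) by simp
  show "a \<oplus>\<^bsub>M\<^esub> b \<in> \<Inter>F" if "a \<in> \<Inter>F" "b \<in> \<Inter>F" for a b
    using that F'(5) by simp
  show "a \<odot>\<^bsub>M\<^esub> x \<in> \<Inter>F" if "a \<in> carrier R" "x \<in> \<Inter>F" for a x
    using that F'(4) by simp
qed

lemma (in Module.module) colon_Int: "colon R M (N \<inter> N') = colon R M N \<inter> colon R M N'"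
  by (auto simp: colon_def)

lemma colon_mono: "N \<subseteq> N' \<Longrightarrow> colon R M N \<subseteq> colon R M N'"
  by (auto simp: colon_def)

lemma (in Module.module) ideal_colon:
  assumes N: "submodule N R M"
  shows "ideal (colon R M N) R"
proof (rule idealI)
  show "ring R" by (rule R.ring_axioms)
  have z: "\<zero>\<^bsub>M\<^esub> \<in> N"
    using subgroup.one_closed[OF submodule.axioms(1)[OF N]] by simp
  show "subgroup (colon R M N) (add_monoid R)"
  proof (rule R.add.subgroupI)
    show "colon R M N \<noteq> {}"
      using z smult_l_null by (auto simp: colon_def)
    fix a assume a: "a \<in> colon R M N"
    show "\<ominus> a \<in> colon R M N"
      using a submoduleE(3)[OF N] smult_l_minus by (auto simp: colon_def)
    fix b assume "b \<in> colon R M N"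
    then show "a \<oplus> b \<in> colon R M N"
      using a submoduleE(5)[OF N] by (auto simp: colon_def smult_l_distr)
  qed (auto simp: colon_def)
  fix a x assume a: "a \<in> colon R M N" and x: "x \<in> carrier R"
  then show 1: "x \<otimes> a \<in> colon R M N"
    using submoduleE(4)[OF N] by (auto simp: colon_def smult_assoc1)
  show "a \<otimes> x \<in> colon R M N"
    using 1 a x R.m_comm by (auto simp: colon_def)
qed

lemma (in Module.module) istopology_dev_zariski:
  "istopology (\<lambda>U. \<exists>N. submodule N R M \<and> U = qSpec R M - DM R M N)"
  unfolding istopology_def
proof (intro conjI allI impI)
  fix U V
  assume "\<exists>N. submodule N R M \<and> U = qSpec R M - DM R M N"
    and "\<exists>N. submodule N R M \<and> V = qSpec R M - DM R M N"
  then obtain N N' where N: "submodule N R M" "U = qSpec R M - DM R M N"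
    and N': "submodule N' R M" "V = qSpec R M - DM R M N'"
    by blast
  have sub: "submodule (N \<inter> N') R M"
    using submodule_Inter[of "{N, N'}"] N N' by auto
  have "colon R M (N \<inter> N') \<subseteq> colon R M L \<longleftrightarrow>
      colon R M N \<subseteq> colon R M L \<or> colon R M N' \<subseteq> colon R M L" if "L \<in> qSpec R M" for L
  proof -
    have "quasi_prime_ideal (colon R M L) R" using that by (simp add: qSpec_def)
    then show ?thesis
      using ideal_colon[OF N(1)] ideal_colon[OF N'(1)]
      unfolding quasi_prime_ideal_def colon_Int by (meson le_infI1 le_infI2)
  qed
  then have "DM R M (N \<inter> N') = DM R M N \<union> DM R M N'"
    unfolding DM_def by fast
  then have "U \<inter> V = qSpec R M - DM R M (N \<inter> N')"
    unfolding N(2) N'(2) by fast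
  then show "\<exists>N. submodule N R M \<and> U \<inter> V = qSpec R M - DM R M N"
    using sub by (intro exI[of _ "N \<inter> N'"] conjI)
next
  fix K
  assume K: "\<forall>U\<in>K. \<exists>N. submodule N R M \<and> U = qSpec R M - DM R M N"
  define G where "G = {N. submodule N R M \<and> qSpec R M - DM R M N \<in> K}"
  define H where "H = \<Inter>{N'. submodule N' R M \<and>
     (\<forall>N\<in>G. \<forall>r\<in>colon R M N. \<forall>x\<in>carrier M. r \<odot>\<^bsub>M\<^esub> x \<in> N')}"
  have "submodule H R M"
    unfolding H_def
    by (rule submodule_Inter) (use carrier_is_submodule in \<open>auto simp: colon_def\<close>)
  moreover have DM_H: "DM R M H = {L \<in> qSpec R M. \<forall>N\<in>G. L \<in> DM R M N}"
  proof (intro equalityI subsetI)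
    fix L assume L: "L \<in> DM R M H"
    have "colon R M N \<subseteq> colon R M H" if "N \<in> G" for N
      using that unfolding H_def colon_def by auto
    then show "L \<in> {L \<in> qSpec R M. \<forall>N\<in>G. L \<in> DM R M N}"
      using L unfolding DM_def by blast
  next
    fix L assume L: "L \<in> {L \<in> qSpec R M. \<forall>N\<in>G. L \<in> DM R M N}"
    then have "submodule L R M" by (auto simp: qSpec_def)
    moreover have "r \<odot>\<^bsub>M\<^esub> x \<in> L" if "N \<in> G" "r \<in> colon R M N" "x \<in> carrier M" for N r x
    proof -
      have "r \<in> colon R M L" using L that by (auto simp: DM_def)
      then show ?thesis using that by (simp add: colon_def)
    qed
    ultimately have "H \<subseteq> L" unfolding H_def by blast
    then show "L \<in> DM R M H"
      using L colon_mono[of H L R M] by (auto simp: DM_def)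
  qed
  moreover have Union_K: "\<Union>K = {L \<in> qSpec R M. \<exists>N\<in>G. L \<notin> DM R M N}"
  proof (intro equalityI subsetI)
    fix L assume "L \<in> \<Union>K"
    then obtain U where U: "U \<in> K" "L \<in> U" by blast
    with K obtain N where "submodule N R M" "U = qSpec R M - DM R M N" by metis
    with U have "N \<in> G" "L \<in> qSpec R M - DM R M N" by (simp_all add: G_def)
    then show "L \<in> {L \<in> qSpec R M. \<exists>N\<in>G. L \<notin> DM R M N}" by auto
  next
    fix L assume "L \<in> {L \<in> qSpec R M. \<exists>N\<in>G. L \<notin> DM R M N}"
    then obtain N where "N \<in> G" "L \<in> qSpec R M - DM R M N" by blast
    then show "L \<in> \<Union>K" by (intro UnionI[of "qSpec R M - DM R M N"]) (simp_all add: G_def)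
  qed
  moreover have "\<Union>K = qSpec R M - DM R M H"
    unfolding Union_K DM_H by fast
  ultimately show "\<exists>N. submodule N R M \<and> \<Union>K = qSpec R M - DM R M N"
    by (intro exI[of _ H] conjI)
qed

lemma (in Module.module) openin_dev_zariski:
  "openin (dev_zariski R M) U \<longleftrightarrow> (\<exists>N. submodule N R M \<and> U = qSpec R M - DM R M N)"
  by (simp only: dev_zariski_def topology_inverse'[OF istopology_dev_zariski])

lemma (in Module.module) topspace_dev_zariski: "topspace (dev_zariski R M) = qSpec R M"
proof -
  have "DM R M (carrier M) = {}"
  proof -
    have "False" if L: "L \<in> DM R M (carrier M)" for L
    proof -
      have "\<one> \<in> colon R M L"
        using L by (auto simp: DM_def colon_def)
      then have "carrier M \<subseteq> L" by (auto simp: colon_def)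
      then show False
        using L submoduleE(1) by (auto simp: DM_def qSpec_def)
    qed
    then show ?thesis by blast
  qed
  then have "openin (dev_zariski R M) (qSpec R M)"
    unfolding openin_dev_zariski by (intro exI[of _ "carrier M"]) (simp add: carrier_is_submodule)
  moreover have "U \<subseteq> qSpec R M" if "openin (dev_zariski R M) U" for U
    using that by (auto simp: openin_dev_zariski)
  ultimately show ?thesis
    by (metis openin_subset openin_topspace subset_antisym)
qed

lemma (in Module.module) closedin_dev_zariski:
  "closedin (dev_zariski R M) C \<longleftrightarrow> (\<exists>N. submodule N R M \<and> C = DM R M N)"
proof
  assume "closedin (dev_zariski R M) C"
  then obtain N where "C \<subseteq> qSpec R M" "submodule N R M" "qSpec R M - C = qSpec R M - DM R M N"
    unfolding closedin_def topspace_dev_zariski openin_dev_zariski by metis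
  moreover have "DM R M N \<subseteq> qSpec R M" by (auto simp: DM_def)
  ultimately show "\<exists>N. submodule N R M \<and> C = DM R M N"
    by (metis double_diff subset_refl)
next
  assume "\<exists>N. submodule N R M \<and> C = DM R M N"
  then obtain N where "submodule N R M" "C = DM R M N" by metis
  moreover have "DM R M N \<subseteq> qSpec R M" by (auto simp: DM_def)
  ultimately show "closedin (dev_zariski R M) C"
    unfolding closedin_def topspace_dev_zariski openin_dev_zariski by metis
qed


section \<open>Localization, arithmetical and Laskerian rings\<close>

text \<open>For a multiplicative set \<open>S\<close> of \<open>R\<close>, the elements of \<open>S\<^sup>-\<^sup>1 R\<close> are the classes of pairs
  \<open>(a, s)\<close>, to be read as \<open>a/s\<close>; \<open>a/s = b/t\<close> iff \<open>u(ta - sb) = 0\<close> for some \<open>u \<in> S\<close>.\<close>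

definition frac_rel :: "('a, 'c) ring_scheme \<Rightarrow> 'a set \<Rightarrow> (('a \<times> 'a) \<times> ('a \<times> 'a)) set" where
  "frac_rel R S = {((a, s), (b, t)). a \<in> carrier R \<and> s \<in> S \<and> b \<in> carrier R \<and> t \<in> S \<and>
     (\<exists>u\<in>S. u \<otimes>\<^bsub>R\<^esub> (t \<otimes>\<^bsub>R\<^esub> a \<ominus>\<^bsub>R\<^esub> s \<otimes>\<^bsub>R\<^esub> b) = \<zero>\<^bsub>R\<^esub>)}"

definition loc_frac :: "('a, 'c) ring_scheme \<Rightarrow> 'a set \<Rightarrow> 'a \<Rightarrow> 'a \<Rightarrow> ('a \<times> 'a) set" where
  "loc_frac R S a s = frac_rel R S `` {(a, s)}"

definition localization :: "('a, 'c) ring_scheme \<Rightarrow> 'a set \<Rightarrow> ('a \<times> 'a) set ring" where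
  "localization R S =
     \<lparr>carrier = (carrier R \<times> S) // frac_rel R S,
      mult = (\<lambda>X Y. \<Union>(a, s)\<in>X. \<Union>(b, t)\<in>Y. loc_frac R S (a \<otimes>\<^bsub>R\<^esub> b) (s \<otimes>\<^bsub>R\<^esub> t)),
      one = loc_frac R S \<one>\<^bsub>R\<^esub> \<one>\<^bsub>R\<^esub>,
      zero = loc_frac R S \<zero>\<^bsub>R\<^esub> \<one>\<^bsub>R\<^esub>,
      add = (\<lambda>X Y. \<Union>(a, s)\<in>X. \<Union>(b, t)\<in>Y.
               loc_frac R S (t \<otimes>\<^bsub>R\<^esub> a \<oplus>\<^bsub>R\<^esub> s \<otimes>\<^bsub>R\<^esub> b) (s \<otimes>\<^bsub>R\<^esub> t))\<rparr>"

definition serial_ring :: "('a, 'c) ring_scheme \<Rightarrow> bool" where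
  "serial_ring R \<longleftrightarrow> (\<forall>I J. ideal I R \<and> ideal J R \<longrightarrow> I \<subseteq> J \<or> J \<subseteq> I)"

definition arithmetical :: "('a, 'c) ring_scheme \<Rightarrow> bool" where
  "arithmetical R \<longleftrightarrow>
     (\<forall>\<pp>. maximalideal \<pp> R \<longrightarrow> serial_ring (localization R (carrier R - \<pp>)))"

definition primary_ideal :: "'a set \<Rightarrow> ('a, 'c) ring_scheme \<Rightarrow> bool" where
  "primary_ideal Q R \<longleftrightarrow> ideal Q R \<and> Q \<noteq> carrier R \<and>
     (\<forall>a\<in>carrier R. \<forall>b\<in>carrier R. a \<otimes>\<^bsub>R\<^esub> b \<in> Q \<longrightarrow>
        a \<in> Q \<or> (\<exists>n::nat. b [^]\<^bsub>R\<^esub> n \<in> Q))"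

definition laskerian :: "('a, 'c) ring_scheme \<Rightarrow> bool" where
  "laskerian R \<longleftrightarrow> (\<forall>I. ideal I R \<and> I \<noteq> carrier R \<longrightarrow>
     (\<exists>F. finite F \<and> F \<noteq> {} \<and> (\<forall>Q\<in>F. primary_ideal Q R) \<and> I = \<Inter>F))"

text \<open>Since \<open>ideal I A\<close> presupposes that \<open>A\<close> is a ring, \<open>serial_ring\<close> would hold vacuously of a
  record that is not a ring; the localizations above are commutative rings.\<close>

locale mult_set = cring R for R (structure) +
  fixes S
  assumes S_sub: "S \<subseteq> carrier R" and S_one: "\<one> \<in> S"
    and S_mult: "\<And>s t. s \<in> S \<Longrightarrow> t \<in> S \<Longrightarrow> s \<otimes> t \<in> S"
begin

lemma S_carr [simp]: "s \<in> S \<Longrightarrow> s \<in> carrier R"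
  using S_sub by blast

lemmas S_simps [simp] = S_one S_mult

lemma equiv_frac_rel: "equiv (carrier R \<times> S) (frac_rel R S)"
proof (rule equivI)
  show "frac_rel R S \<subseteq> (carrier R \<times> S) \<times> (carrier R \<times> S)"
    by (auto simp: frac_rel_def)
  show "refl_on (carrier R \<times> S) (frac_rel R S)"
    by (rule refl_onI) (auto simp: frac_rel_def minus_eq r_neg intro!: bexI[of _ "\<one>"])
  show "sym (frac_rel R S)"
  proof (rule symI)
    fix x y assume "(x, y) \<in> frac_rel R S"
    then obtain a s b t u where c: "x = (a, s)" "y = (b, t)" "a \<in> carrier R" "b \<in> carrier R"
      "s \<in> S" "t \<in> S" "u \<in> S" and e: "u \<otimes> (t \<otimes> a \<ominus> s \<otimes> b) = \<zero>"
      by (auto simp: frac_rel_def)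
    have "u \<otimes> (s \<otimes> b \<ominus> t \<otimes> a) = \<ominus> (u \<otimes> (t \<otimes> a \<ominus> s \<otimes> b))"
      using c S_carr by algebra
    also have "\<dots> = \<zero>" by (simp add: e)
    finally show "(y, x) \<in> frac_rel R S"
      using c by (auto simp: frac_rel_def)
  qed
  show "trans (frac_rel R S)"
  proof (rule transI)
    fix x y z assume "(x, y) \<in> frac_rel R S" "(y, z) \<in> frac_rel R S"
    then obtain a s b t c r u v where c: "x = (a, s)" "y = (b, t)" "z = (c, r)"
      "a \<in> carrier R" "b \<in> carrier R" "c \<in> carrier R"
      "s \<in> S" "t \<in> S" "r \<in> S" "u \<in> S" "v \<in> S"
      and e: "u \<otimes> (t \<otimes> a \<ominus> s \<otimes> b) = \<zero>" "v \<otimes> (r \<otimes> b \<ominus> t \<otimes> c) = \<zero>"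
      by (auto simp: frac_rel_def)
    have carr: "s \<in> carrier R" "t \<in> carrier R" "r \<in> carrier R" "u \<in> carrier R" "v \<in> carrier R"
      using c by auto
    have "u \<otimes> v \<otimes> t \<otimes> (r \<otimes> a \<ominus> s \<otimes> c) =
        v \<otimes> r \<otimes> (u \<otimes> (t \<otimes> a \<ominus> s \<otimes> b)) \<oplus> u \<otimes> s \<otimes> (v \<otimes> (r \<otimes> b \<ominus> t \<otimes> c))"
      using c carr by algebra
    also have "\<dots> = \<zero>" using carr by (simp add: e)
    finally show "(x, z) \<in> frac_rel R S"
      using c by (auto simp: frac_rel_def intro!: bexI[of _ "u \<otimes> v \<otimes> t"])
  qed
qed

lemma frac_eqI:
  assumes "a \<in> carrier R" "b \<in> carrier R" "s \<in> S" "t \<in> S" "u \<in> S"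
    and "u \<otimes> (t \<otimes> a \<ominus> s \<otimes> b) = \<zero>"
  shows "loc_frac R S a s = loc_frac R S b t"
  unfolding loc_frac_def
  by (rule equiv_class_eq[OF equiv_frac_rel]) (use assms in \<open>auto simp: frac_rel_def\<close>)

lemma frac_eq_iff:
  assumes "a \<in> carrier R" "b \<in> carrier R" "s \<in> S" "t \<in> S"
  shows "loc_frac R S a s = loc_frac R S b t \<longleftrightarrow> (\<exists>u\<in>S. u \<otimes> (t \<otimes> a \<ominus> s \<otimes> b) = \<zero>)"
  unfolding loc_frac_def
  by (subst eq_equiv_class_iff[OF equiv_frac_rel]) (use assms in \<open>auto simp: frac_rel_def\<close>)

lemma frac_eqI1:
  assumes "a \<in> carrier R" "b \<in> carrier R" "s \<in> S" "t \<in> S" and "t \<otimes> a = s \<otimes> b"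
  shows "loc_frac R S a s = loc_frac R S b t"
  by (rule frac_eqI[of _ _ _ _ \<one>]) (use assms in \<open>auto simp: minus_eq r_neg\<close>)

lemma frac_closed [simp]:
  "a \<in> carrier R \<Longrightarrow> s \<in> S \<Longrightarrow> loc_frac R S a s \<in> carrier (localization R S)"
  by (auto simp: localization_def loc_frac_def intro: quotientI)

lemma localization_cases:
  assumes "X \<in> carrier (localization R S)"
  obtains a s where "a \<in> carrier R" "s \<in> S" "X = loc_frac R S a s"
  using assms by (auto simp: localization_def loc_frac_def elim!: quotientE)

lemma mult_frac [simp]:
  assumes "a \<in> carrier R" "b \<in> carrier R" "s \<in> S" "t \<in> S"
  shows "loc_frac R S a s \<otimes>\<^bsub>localization R S\<^esub> loc_frac R S b t = loc_frac R S (a \<otimes> b) (s \<otimes> t)"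
proof -
  have "(\<lambda>x y. case x of (a, s) \<Rightarrow> case y of (b, t) \<Rightarrow> loc_frac R S (a \<otimes> b) (s \<otimes> t))
      respects2 frac_rel R S"
  proof (rule congruent2_commuteI[OF equiv_frac_rel])
    fix y z assume "y \<in> carrier R \<times> S" "z \<in> carrier R \<times> S"
    then show "(case y of (a, s) \<Rightarrow> case z of (b, t) \<Rightarrow> loc_frac R S (a \<otimes> b) (s \<otimes> t)) =
        (case z of (a, s) \<Rightarrow> case y of (b, t) \<Rightarrow> loc_frac R S (a \<otimes> b) (s \<otimes> t))"
      by (auto simp: m_comm)
  next
    fix y z w assume "w \<in> carrier R \<times> S" "(y, z) \<in> frac_rel R S"
    then obtain a s b t c r u where c: "y = (a, s)" "z = (b, t)" "w = (c, r)"
      "a \<in> carrier R" "b \<in> carrier R" "c \<in> carrier R" "s \<in> S" "t \<in> S" "r \<in> S" "u \<in> S"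
      and e: "u \<otimes> (t \<otimes> a \<ominus> s \<otimes> b) = \<zero>"
      by (auto simp: frac_rel_def)
    have carr: "s \<in> carrier R" "t \<in> carrier R" "r \<in> carrier R" "u \<in> carrier R"
      using c by auto
    have "u \<otimes> (r \<otimes> t \<otimes> (c \<otimes> a) \<ominus> r \<otimes> s \<otimes> (c \<otimes> b)) =
        r \<otimes> c \<otimes> (u \<otimes> (t \<otimes> a \<ominus> s \<otimes> b))"
      using c carr by algebra
    also have "\<dots> = \<zero>" using c carr by (simp add: e)
    finally show "(case w of (a, s) \<Rightarrow> case y of (b, t) \<Rightarrow> loc_frac R S (a \<otimes> b) (s \<otimes> t)) =
        (case w of (a, s) \<Rightarrow> case z of (b, t) \<Rightarrow> loc_frac R S (a \<otimes> b) (s \<otimes> t))"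
      using c(4-) carr unfolding c(1-3) prod.case
      by (intro frac_eqI[of _ _ _ _ u]) simp_all
  qed
  from UN_equiv_class2[OF equiv_frac_rel equiv_frac_rel this, of "(a, s)" "(b, t)"]
  show ?thesis
    using assms by (simp add: localization_def loc_frac_def case_prod_unfold)
qed

lemma add_frac [simp]:
  assumes "a \<in> carrier R" "b \<in> carrier R" "s \<in> S" "t \<in> S"
  shows "loc_frac R S a s \<oplus>\<^bsub>localization R S\<^esub> loc_frac R S b t =
    loc_frac R S (t \<otimes> a \<oplus> s \<otimes> b) (s \<otimes> t)"
proof -
  have "(\<lambda>x y. case x of (a, s) \<Rightarrow> case y of (b, t) \<Rightarrow>
      loc_frac R S (t \<otimes> a \<oplus> s \<otimes> b) (s \<otimes> t)) respects2 frac_rel R S"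
  proof (rule congruent2_commuteI[OF equiv_frac_rel])
    fix y z assume "y \<in> carrier R \<times> S" "z \<in> carrier R \<times> S"
    then show "(case y of (a, s) \<Rightarrow> case z of (b, t) \<Rightarrow>
          loc_frac R S (t \<otimes> a \<oplus> s \<otimes> b) (s \<otimes> t)) =
        (case z of (a, s) \<Rightarrow> case y of (b, t) \<Rightarrow> loc_frac R S (t \<otimes> a \<oplus> s \<otimes> b) (s \<otimes> t))"
      by (auto simp: m_comm a_comm)
  next
    fix y z w assume "w \<in> carrier R \<times> S" "(y, z) \<in> frac_rel R S"
    then obtain a s b t c r u where c: "y = (a, s)" "z = (b, t)" "w = (c, r)"
      "a \<in> carrier R" "b \<in> carrier R" "c \<in> carrier R" "s \<in> S" "t \<in> S" "r \<in> S" "u \<in> S"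
      and e: "u \<otimes> (t \<otimes> a \<ominus> s \<otimes> b) = \<zero>"
      by (auto simp: frac_rel_def)
    have carr: "s \<in> carrier R" "t \<in> carrier R" "r \<in> carrier R" "u \<in> carrier R"
      using c by auto
    have "u \<otimes> (r \<otimes> t \<otimes> (s \<otimes> c \<oplus> r \<otimes> a) \<ominus> r \<otimes> s \<otimes> (t \<otimes> c \<oplus> r \<otimes> b)) =
        r \<otimes> r \<otimes> (u \<otimes> (t \<otimes> a \<ominus> s \<otimes> b))"
      using c carr by algebra
    also have "\<dots> = \<zero>" using c carr by (simp add: e)
    finally show "(case w of (a, s) \<Rightarrow> case y of (b, t) \<Rightarrow>
          loc_frac R S (t \<otimes> a \<oplus> s \<otimes> b) (s \<otimes> t)) =
        (case w of (a, s) \<Rightarrow> case z of (b, t) \<Rightarrow> loc_frac R S (t \<otimes> a \<oplus> s \<otimes> b) (s \<otimes> t))"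
      using c(4-) carr unfolding c(1-3) prod.case
      by (intro frac_eqI[of _ _ _ _ u]) simp_all
  qed
  from UN_equiv_class2[OF equiv_frac_rel equiv_frac_rel this, of "(a, s)" "(b, t)"]
  show ?thesis
    using assms by (simp add: localization_def loc_frac_def case_prod_unfold)
qed

lemma localization_zero [simp]: "\<zero>\<^bsub>localization R S\<^esub> = loc_frac R S \<zero> \<one>"
  and localization_one [simp]: "\<one>\<^bsub>localization R S\<^esub> = loc_frac R S \<one> \<one>"
  by (simp_all add: localization_def)

lemma localization_cring: "cring (localization R S)"
proof (rule cringI)
  let ?L = "localization R S"
  show "abelian_group ?L"
  proof (rule abelian_groupI)
    fix X Y Z assume "X \<in> carrier ?L" "Y \<in> carrier ?L" "Z \<in> carrier ?L"
    then obtain a s b t c r where c: "a \<in> carrier R" "s \<in> S" "X = loc_frac R S a s"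
      "b \<in> carrier R" "t \<in> S" "Y = loc_frac R S b t" "c \<in> carrier R" "r \<in> S" "Z = loc_frac R S c r"
      by (metis localization_cases)
    then have carr: "s \<in> carrier R" "t \<in> carrier R" "r \<in> carrier R" by auto
    have "r \<otimes> (t \<otimes> a \<oplus> s \<otimes> b) \<oplus> s \<otimes> t \<otimes> c = t \<otimes> r \<otimes> a \<oplus> s \<otimes> (r \<otimes> b \<oplus> t \<otimes> c)"
      using c carr by algebra
    then show "X \<oplus>\<^bsub>?L\<^esub> Y \<oplus>\<^bsub>?L\<^esub> Z = X \<oplus>\<^bsub>?L\<^esub> (Y \<oplus>\<^bsub>?L\<^esub> Z)"
      using c by (simp add: m_assoc)
  next
    fix X Y assume "X \<in> carrier ?L" "Y \<in> carrier ?L"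
    then obtain a s b t where c: "a \<in> carrier R" "s \<in> S" "X = loc_frac R S a s"
      "b \<in> carrier R" "t \<in> S" "Y = loc_frac R S b t"
      by (metis localization_cases)
    then show "X \<oplus>\<^bsub>?L\<^esub> Y \<in> carrier ?L" by simp
    show "X \<oplus>\<^bsub>?L\<^esub> Y = Y \<oplus>\<^bsub>?L\<^esub> X" using c by (simp add: m_comm a_comm)
  next
    fix X assume "X \<in> carrier ?L"
    then obtain a s where c: "a \<in> carrier R" "s \<in> S" "X = loc_frac R S a s"
      by (metis localization_cases)
    then show "\<zero>\<^bsub>?L\<^esub> \<oplus>\<^bsub>?L\<^esub> X = X" by simp
    have "s \<otimes> \<ominus> a \<oplus> s \<otimes> a = \<zero>"
      using c S_carr[OF c(2)] by algebra
    moreover have "loc_frac R S \<zero> (s \<otimes> s) = loc_frac R S \<zero> \<one>"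
      using c by (intro frac_eqI1) simp_all
    ultimately have "loc_frac R S (\<ominus> a) s \<oplus>\<^bsub>?L\<^esub> X = \<zero>\<^bsub>?L\<^esub>"
      using c by simp
    then show "\<exists>Y\<in>carrier ?L. Y \<oplus>\<^bsub>?L\<^esub> X = \<zero>\<^bsub>?L\<^esub>"
      using c by (meson a_inv_closed frac_closed)
  qed simp
  show "comm_monoid ?L"
  proof (rule comm_monoidI)
    fix X Y Z assume "X \<in> carrier ?L" "Y \<in> carrier ?L" "Z \<in> carrier ?L"
    then obtain a s b t c r where c: "a \<in> carrier R" "s \<in> S" "X = loc_frac R S a s"
      "b \<in> carrier R" "t \<in> S" "Y = loc_frac R S b t" "c \<in> carrier R" "r \<in> S" "Z = loc_frac R S c r"
      by (metis localization_cases)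
    then show "X \<otimes>\<^bsub>?L\<^esub> Y \<otimes>\<^bsub>?L\<^esub> Z = X \<otimes>\<^bsub>?L\<^esub> (Y \<otimes>\<^bsub>?L\<^esub> Z)"
      by (simp add: m_assoc)
  next
    fix X Y assume "X \<in> carrier ?L" "Y \<in> carrier ?L"
    then obtain a s b t where c: "a \<in> carrier R" "s \<in> S" "X = loc_frac R S a s"
      "b \<in> carrier R" "t \<in> S" "Y = loc_frac R S b t"
      by (metis localization_cases)
    then show "X \<otimes>\<^bsub>?L\<^esub> Y \<in> carrier ?L" by simp
    show "X \<otimes>\<^bsub>?L\<^esub> Y = Y \<otimes>\<^bsub>?L\<^esub> X" using c by (simp add: m_comm)
  next
    fix X assume "X \<in> carrier ?L"
    then show "\<one>\<^bsub>?L\<^esub> \<otimes>\<^bsub>?L\<^esub> X = X" by (auto elim: localization_cases)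
  qed simp
  fix X Y Z assume "X \<in> carrier ?L" "Y \<in> carrier ?L" "Z \<in> carrier ?L"
  then obtain a s b t c r where c: "a \<in> carrier R" "s \<in> S" "X = loc_frac R S a s"
    "b \<in> carrier R" "t \<in> S" "Y = loc_frac R S b t" "c \<in> carrier R" "r \<in> S" "Z = loc_frac R S c r"
    by (metis localization_cases)
  then have carr: "s \<in> carrier R" "t \<in> carrier R" "r \<in> carrier R" by auto
  have "s \<otimes> r \<otimes> (t \<otimes> r) \<otimes> ((t \<otimes> a \<oplus> s \<otimes> b) \<otimes> c) =
      s \<otimes> t \<otimes> r \<otimes> (t \<otimes> r \<otimes> (a \<otimes> c) \<oplus> s \<otimes> r \<otimes> (b \<otimes> c))"
    using c carr by algebra
  then show "(X \<oplus>\<^bsub>?L\<^esub> Y) \<otimes>\<^bsub>?L\<^esub> Z = X \<otimes>\<^bsub>?L\<^esub> Z \<oplus>\<^bsub>?L\<^esub> Y \<otimes>\<^bsub>?L\<^esub> Z"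
    using c by (simp, intro frac_eqI1) simp_all
qed

end

lemma (in cring) mult_set_primeideal:
  assumes "primeideal P R"
  shows "mult_set R (carrier R - P)"
proof -
  interpret primeideal P R by fact
  have "\<one> \<notin> P" using one_imp_carrier I_notcarr by blast
  then show ?thesis
    by unfold_locales (use I_prime in auto)
qed

end

theory Submission
  imports Defs "HOL-Algebra.Ring_Divisibility"
begin

text \<open>A closed irreducible set \<open>Y\<close> is \<open>D(P)\<close> for \<open>P = \<Inter>Y\<close>: if \<open>A \<inter> B \<subseteq> (P : M)\<close>, every member of
  \<open>Y\<close> lies in the closed set cut out by \<open>A\<close> or the one cut out by \<open>B\<close>, and irreducibility makes
  one choice uniform. As \<open>D(L)\<close> is the closure of \<open>{L}\<close>, components correspond to minimal values of
  \<open>(L : M)\<close>; if \<open>M\<close> is quasi-primeful, these values are all the quasi-prime ideals above \<open>Ann(M)\<close>.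
  For an arithmetical ring, localizing at a maximal ideal above a primary ideal shows that the
  latter is quasi-prime, so the minimal quasi-prime ideals above \<open>Ann(M)\<close> occur in any
  primary decomposition of \<open>Ann(M)\<close>.\<close>

section \<open>Irreducible subsets\<close>

text \<open>Complements turn non-empty relatively open sets into closed sets of \<open>X\<close>
  that do not contain \<open>S\<close>. Irreducibility is wanted in this form because the developed
  Zariski topology is given by its closed sets.\<close>

lemma irreducible_subset_iff_closedin:
  "irreducible_subset X S \<longleftrightarrow> S \<subseteq> topspace X \<and> S \<noteq> {} \<and>
     (\<forall>C D. closedin X C \<and> closedin X D \<and> S \<subseteq> C \<union> D \<longrightarrow> S \<subseteq> C \<or> S \<subseteq> D)"
proof (cases "S \<subseteq> topspace X")
  case True
  have irr: "(\<forall>U V. openin (subtopology X S) U \<and> openin (subtopology X S) V \<and> U \<noteq> {} \<and> V \<noteq> {} \<longrightarrow>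
          U \<inter> V \<noteq> {}) \<longleftrightarrow>
        (\<forall>C D. closedin X C \<and> closedin X D \<and> S \<subseteq> C \<union> D \<longrightarrow> S \<subseteq> C \<or> S \<subseteq> D)"
    (is "?l \<longleftrightarrow> ?r")
  proof
    assume l: ?l
    show ?r
    proof (intro allI impI)
      fix C D assume a: "closedin X C \<and> closedin X D \<and> S \<subseteq> C \<union> D"
      then have "openin (subtopology X S) ((topspace X - C) \<inter> S)"
        "openin (subtopology X S) ((topspace X - D) \<inter> S)"
        by (auto intro: openin_subtopology_Int)
      moreover have "((topspace X - C) \<inter> S) \<inter> ((topspace X - D) \<inter> S) = {}"
        using a by auto
      ultimately have "(topspace X - C) \<inter> S = {} \<or> (topspace X - D) \<inter> S = {}"
        using l by blast
      then show "S \<subseteq> C \<or> S \<subseteq> D" using True by blast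
    qed
  next
    assume r: ?r
    show ?l
    proof (intro allI impI)
      fix U V
      assume a: "openin (subtopology X S) U \<and> openin (subtopology X S) V \<and> U \<noteq> {} \<and> V \<noteq> {}"
      then obtain U' V' where o: "openin X U'" "U = U' \<inter> S" "openin X V'" "V = V' \<inter> S"
        by (auto simp: openin_subtopology)
      then have "closedin X (topspace X - U')" "closedin X (topspace X - V')"
        by (auto intro: openin_closedin_eq[THEN iffD1, THEN conjunct2])
      moreover have "\<not> S \<subseteq> topspace X - U'" "\<not> S \<subseteq> topspace X - V'"
        using a o by auto
      ultimately have "\<not> S \<subseteq> (topspace X - U') \<union> (topspace X - V')"
        using r by blast
      then show "U \<inter> V \<noteq> {}"
        using True unfolding o(2,4) by blast
    qed
  qed
  have top: "topspace (subtopology X S) = S" using True by (simp add: Int_absorb1)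
  show ?thesis
    unfolding irreducible_subset_def irreducible_space_def irr top ..
qed (auto simp: irreducible_subset_def)

text \<open>A closed set contains \<open>S\<close> exactly when it contains the closure of
  \<open>S\<close>, so the criterion by closed covers passes from one to the other.\<close>

lemma irreducible_subset_closure_of:
  assumes "irreducible_subset X S"
  shows "irreducible_subset X (X closure_of S)"
proof -
  have S: "S \<subseteq> topspace X" "S \<noteq> {}" using assms by (auto simp: irreducible_subset_iff_closedin)
  then have sub: "S \<subseteq> X closure_of S" by (simp add: closure_of_subset)
  show ?thesis
    unfolding irreducible_subset_iff_closedin
  proof (intro conjI allI impI)
    fix C D assume a: "closedin X C \<and> closedin X D \<and> X closure_of S \<subseteq> C \<union> D"
    then have "S \<subseteq> C \<or> S \<subseteq> D"
      using assms sub unfolding irreducible_subset_iff_closedin by (meson subset_trans)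
    then show "X closure_of S \<subseteq> C \<or> X closure_of S \<subseteq> D"
      using a by (meson closure_of_minimal)
  qed (use S sub closure_of_subset_topspace[of X S] in auto)
qed

text \<open>A maximal irreducible set equals its closure, which is again irreducible. Conversely,
  every irreducible set above \<open>C\<close> lies in its irreducible closure, so testing
  maximality against closed sets suffices.\<close>

lemma irreducible_components_iff_closedin:
  "C \<in> irreducible_components X \<longleftrightarrow> closedin X C \<and> irreducible_subset X C \<and>
     (\<forall>C'. closedin X C' \<and> irreducible_subset X C' \<and> C \<subseteq> C' \<longrightarrow> C' = C)" (is "_ \<longleftrightarrow> ?r")
proof
  assume "C \<in> irreducible_components X"
  then have C: "irreducible_subset X C" "\<And>C'. irreducible_subset X C' \<Longrightarrow> C \<subseteq> C' \<Longrightarrow> C' = C"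
    by (auto simp: irreducible_components_def)
  have "X closure_of C = C"
    using C(2)[OF irreducible_subset_closure_of[OF C(1)]] C(1)
    by (simp add: closure_of_subset irreducible_subset_def)
  then show ?r using C by (metis closedin_closure_of)
next
  assume r: ?r
  have "C' = C" if C': "irreducible_subset X C'" "C \<subseteq> C'" for C'
  proof -
    have "C' \<subseteq> X closure_of C'"
      using C'(1) by (simp add: closure_of_subset irreducible_subset_def)
    moreover from this have "X closure_of C' = C"
      using r irreducible_subset_closure_of[OF C'(1)] C'(2)
      by (meson closedin_closure_of subset_trans)
    ultimately show ?thesis using C'(2) by blast
  qed
  then show "C \<in> irreducible_components X"
    using r by (auto simp: irreducible_components_def)
qed


section \<open>Quasi-prime ideals\<close>

text \<open>Induction on \<open>F\<close> splits off one ideal at a time. The result is applied to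
  primary decompositions.\<close>

lemma quasi_prime_ideal_finite_Inter:
  assumes R: "ring R" and P: "quasi_prime_ideal P R" and "finite F" "F \<noteq> {}"
    and "\<And>Q. Q \<in> F \<Longrightarrow> ideal Q R" and "\<Inter>F \<subseteq> P"
  shows "\<exists>Q\<in>F. Q \<subseteq> P"
  using assms(3-)
proof (induction F rule: finite_ne_induct)
  case (insert Q F)
  have "ideal (\<Inter>F) R"
    using insert by (intro ring.i_Intersect[OF R]) auto
  then have "Q \<subseteq> P \<or> \<Inter>F \<subseteq> P"
    using P insert.prems unfolding quasi_prime_ideal_def by (metis Inter_insert insertI1)
  then show ?case using insert by auto
qed auto

text \<open>Every ideal of the quotient is the image of an ideal of \<open>R\<close>, so an
  intersection condition modulo \<open>J\<close> can be lifted to \<open>R\<close> and decided there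
  by \<open>I\<close>.\<close>

lemma (in ring) quasi_prime_ideal_quotient:
  assumes J: "ideal J R" and I: "quasi_prime_ideal I R" and "J \<subseteq> I"
  shows "quasi_prime_ideal ((+>) J ` I) (R Quot J)"
proof -
  interpret J: ideal J R by (rule J)
  note corr = quot_ideal_correspondence[OF J]
  have idI: "ideal I R" and I_ne: "I \<noteq> carrier R" using I by (auto simp: quasi_prime_ideal_def)
  \<comment> \<open>Since \<open>I\<close> contains \<open>J\<close>, it is a union of cosets of
    \<open>J\<close>, and membership in \<open>I\<close> can be read off from the coset.\<close>
  have mem: "r \<in> I" if r: "r \<in> carrier R" "J +> r \<in> (+>) J ` I" for r
  proof -
    have "r \<in> J +> r" by (rule J.a_rcos_self[OF r(1)])
    then have "r \<in> (\<Union>i\<in>I. J +> i)" using r(2) by auto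
    then show ?thesis
      by (rule subsetD[OF equalityD2[OF iffD1[OF ideal_incl_iff[OF J idI] \<open>J \<subseteq> I\<close>]]])
  qed
  have surj: "\<exists>A'. ideal A' R \<and> A = (+>) J ` A'" if "ideal A (R Quot J)" for A
  proof -
    have "A \<in> (\<lambda>K. (+>) J ` K) ` {K. ideal K R \<and> J \<subseteq> K}"
      using that by (simp add: bij_betw_imp_surj_on[OF corr])
    then show ?thesis by blast
  qed
  show ?thesis
    unfolding quasi_prime_ideal_def
  proof (intro conjI allI impI)
    show "ideal ((+>) J ` I) (R Quot J)"
      using corr idI \<open>J \<subseteq> I\<close> by (auto simp: bij_betw_def)
    show "(+>) J ` I \<noteq> carrier (R Quot J)"
    proof
      assume eq: "(+>) J ` I = carrier (R Quot J)"
      have "carrier R \<subseteq> I"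
      proof
        fix r assume r: "r \<in> carrier R"
        then have "J +> r \<in> carrier (R Quot J)"
          by (auto simp: FactRing_def A_RCOSETS_def')
        then show "r \<in> I" using mem r eq by blast
      qed
      then show False using I_ne ideal.Icarr[OF idI] by blast
    qed
    fix A B assume a: "ideal A (R Quot J) \<and> ideal B (R Quot J) \<and> A \<inter> B \<subseteq> (+>) J ` I"
    obtain A' where A': "ideal A' R" "A = (+>) J ` A'" using surj a by metis
    obtain B' where B': "ideal B' R" "B = (+>) J ` B'" using surj a by metis
    have "A' \<inter> B' \<subseteq> I"
    proof
      fix r assume r: "r \<in> A' \<inter> B'"
      then have "J +> r \<in> A \<inter> B" by (simp add: A' B')
      then show "r \<in> I"
        using mem[of r] a ideal.Icarr[OF A'(1), of r] r by blast
    qed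
    then have "A' \<subseteq> I \<or> B' \<subseteq> I" using I A' B' by (auto simp: quasi_prime_ideal_def)
    then show "A \<subseteq> (+>) J ` I \<or> B \<subseteq> (+>) J ` I" using A' B' by auto
  qed
qed

section \<open>Maximal ideals, localization and primary ideals of arithmetical rings\<close>

lemma (in ring) exists_maximalideal:
  assumes I: "ideal I R" "I \<noteq> carrier R"
  obtains \<mm> where "maximalideal \<mm> R" "I \<subseteq> \<mm>"
proof -
  define F where "F = {J. ideal J R \<and> J \<noteq> carrier R \<and> I \<subseteq> J}"
  have "\<exists>\<mm>\<in>F. \<forall>J\<in>F. \<mm> \<subseteq> J \<longrightarrow> J = \<mm>"
  proof (rule subset_Zorn)
    fix C assume C: "subset.chain F C"
    show "\<exists>U\<in>F. \<forall>J\<in>C. J \<subseteq> U"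
    \<comment> \<open>The union of the empty chain is not an ideal, so \<open>I\<close> itself
      serves as its bound. Otherwise the union is an ideal, and it is proper because no member
      contains \<open>\<one>\<close>.\<close>
    proof (cases "C = {}")
      case True
      then show ?thesis using I by (auto simp: F_def)
    next
      case False
      have CF: "C \<subseteq> F" using C by (simp add: subset_chain_def)
      have "subset.chain {I. ideal I R} C"
        using C by (auto simp: subset_chain_def F_def)
      then have id: "ideal (\<Union>C) R"
        using chain_Union_is_ideal[of C] False by simp
      have "\<one> \<notin> J" if "J \<in> C" for J
        using that CF ideal.one_imp_carrier unfolding F_def by blast
      then have "\<Union>C \<noteq> carrier R" by blast
      then have "\<Union>C \<in> F" using id False CF by (auto simp: F_def)
      then show ?thesis by blast
    qed
  qed
  then obtain \<mm> where m: "\<mm> \<in> F" "\<And>J. J \<in> F \<Longrightarrow> \<mm> \<subseteq> J \<Longrightarrow> J = \<mm>" by blast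
  have "maximalideal \<mm> R"
  proof (rule maximalidealI)
    fix J assume J: "ideal J R" "\<mm> \<subseteq> J" "J \<subseteq> carrier R"
    show "J = \<mm> \<or> J = carrier R"
    proof (cases "J = carrier R")
      case False
      then have "J \<in> F" using J m(1) by (auto simp: F_def)
      then show ?thesis using m(2) J(2) by blast
    qed simp
  qed (use m(1) in \<open>auto simp: F_def\<close>)
  then show ?thesis using m(1) that by (auto simp: F_def)
qed

text \<open>In the localization the principal ideals of \<open>a/1\<close> and \<open>b/1\<close>
  are comparable, so one fraction is a multiple of the other. Clearing denominators gives the
  equation in \<open>R\<close>.\<close>

lemma (in cring) serial_localization_dvd:
  assumes P: "primeideal P R" and ser: "serial_ring (localization R (carrier R - P))"
    and a: "a \<in> carrier R" and b: "b \<in> carrier R"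
  obtains t c where "t \<in> carrier R - P" "c \<in> carrier R" "t \<otimes> a = c \<otimes> b \<or> t \<otimes> b = c \<otimes> a"
proof -
  define S where "S = carrier R - P"
  interpret mult_set R S unfolding S_def by (rule mult_set_primeideal[OF P])
  interpret L: cring "localization R S" by (rule localization_cring)
  have dvd: "\<exists>t\<in>S. \<exists>c\<in>carrier R. t \<otimes> x = c \<otimes> y"
    if x: "x \<in> carrier R" and y: "y \<in> carrier R"
      and sub: "PIdl\<^bsub>localization R S\<^esub> (loc_frac R S x \<one>) \<subseteq> PIdl\<^bsub>localization R S\<^esub> (loc_frac R S y \<one>)"
    for x y
  proof -
    have "loc_frac R S x \<one> \<in> PIdl\<^bsub>localization R S\<^esub> (loc_frac R S y \<one>)"
      using L.cgenideal_self[of "loc_frac R S x \<one>"] x sub by auto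
    then obtain Z where Z: "Z \<in> carrier (localization R S)"
      "loc_frac R S x \<one> = Z \<otimes>\<^bsub>localization R S\<^esub> loc_frac R S y \<one>"
      by (auto simp: cgenideal_def)
    then obtain c s where c: "c \<in> carrier R" "s \<in> S" "Z = loc_frac R S c s"
      by (metis localization_cases)
    then have "loc_frac R S x \<one> = loc_frac R S (c \<otimes> y) s"
      using Z(2) y by simp
    then obtain u where u: "u \<in> S" "u \<otimes> (s \<otimes> x \<ominus> \<one> \<otimes> (c \<otimes> y)) = \<zero>"
      using frac_eq_iff[of x "c \<otimes> y" \<one> s] x y c by auto
    have carr: "u \<in> carrier R" "s \<in> carrier R" using u c by auto
    \<comment> \<open>The first summand vanishes by the choice of \<open>u\<close>, so
      \<open>u \<otimes> s\<close>, which lies in \<open>S\<close>, and \<open>u \<otimes> c\<close>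
      are the required witnesses.\<close>
    have "u \<otimes> s \<otimes> x = u \<otimes> (s \<otimes> x \<ominus> \<one> \<otimes> (c \<otimes> y)) \<oplus> u \<otimes> c \<otimes> y"
      using carr c(1) x y by algebra
    also have "\<dots> = u \<otimes> c \<otimes> y" using u carr c y by simp
    finally show ?thesis using u c carr by (meson S_mult m_closed)
  qed
  have "ideal (PIdl\<^bsub>localization R S\<^esub> (loc_frac R S a \<one>)) (localization R S)"
    "ideal (PIdl\<^bsub>localization R S\<^esub> (loc_frac R S b \<one>)) (localization R S)"
    by (rule L.cgenideal_ideal, simp add: a b)+
  then have "PIdl\<^bsub>localization R S\<^esub> (loc_frac R S a \<one>) \<subseteq> PIdl\<^bsub>localization R S\<^esub> (loc_frac R S b \<one>) \<or>
      PIdl\<^bsub>localization R S\<^esub> (loc_frac R S b \<one>) \<subseteq> PIdl\<^bsub>localization R S\<^esub> (loc_frac R S a \<one>)"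
    using ser unfolding serial_ring_def S_def[symmetric] by simp
  then have "(\<exists>t\<in>S. \<exists>c\<in>carrier R. t \<otimes> a = c \<otimes> b) \<or> (\<exists>t\<in>S. \<exists>c\<in>carrier R. t \<otimes> b = c \<otimes> a)"
    using dvd[OF a b] dvd[OF b a] by blast
  then show ?thesis using that unfolding S_def by blast
qed

text \<open>Elements outside a maximal ideal \<open>\<mm>\<close> above \<open>Q\<close> can be
  cancelled modulo \<open>Q\<close>. If \<open>a\<close> in \<open>A\<close> and \<open>b\<close> in
  \<open>B\<close> both avoided \<open>Q\<close>, seriality at \<open>\<mm>\<close> would put a
  multiple of one of them by such an element into \<open>A \<inter> B\<close>, hence into
  \<open>Q\<close>, and cancelling would give a contradiction.\<close>

lemma (in cring) primary_imp_quasi_prime: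
  assumes ar: "arithmetical R" and Q: "primary_ideal Q R"
  shows "quasi_prime_ideal Q R"
proof -
  have idQ: "ideal Q R" "Q \<noteq> carrier R" using Q by (auto simp: primary_ideal_def)
  obtain \<mm> where m: "maximalideal \<mm> R" "Q \<subseteq> \<mm>"
    using exists_maximalideal[OF idQ] .
  interpret P: primeideal \<mm> R using maximalideal_prime[OF m(1)] .
  have pow: "t \<in> \<mm>" if "t \<in> carrier R" "t [^] n \<in> \<mm>" for t and n :: nat
    using that(2)
  proof (induction n)
    \<comment> \<open>The definition of \<open>primary_ideal\<close> admits the exponent zero. The
      power is then \<open>\<one>\<close>, which the proper ideal \<open>\<mm>\<close>
      omits.\<close>
    case 0
    then show ?case using P.one_imp_carrier P.I_notcarr by simp
  next
    case (Suc n)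
    then show ?case using P.I_prime[of "t [^] n" t] that(1) by auto
  qed
  have cancel: "a \<in> Q" if "t \<in> carrier R - \<mm>" "a \<in> carrier R" "t \<otimes> a \<in> Q" for t a
  proof -
    have "a \<otimes> t \<in> Q" using that by (simp add: m_comm)
    then have "a \<in> Q \<or> (\<exists>n::nat. t [^] n \<in> Q)"
      using Q that unfolding primary_ideal_def by blast
    then show ?thesis using that pow m(2) by blast
  qed
  have "A \<subseteq> Q \<or> B \<subseteq> Q" if A: "ideal A R" and B: "ideal B R" and AB: "A \<inter> B \<subseteq> Q" for A B
  proof (rule ccontr)
    assume "\<not> (A \<subseteq> Q \<or> B \<subseteq> Q)"
    then obtain a b where ab: "a \<in> A" "a \<notin> Q" "b \<in> B" "b \<notin> Q" by blast
    then have carr: "a \<in> carrier R" "b \<in> carrier R"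
      using ideal.Icarr[OF A] ideal.Icarr[OF B] by auto
    have "serial_ring (localization R (carrier R - \<mm>))"
      using ar m(1) by (simp add: arithmetical_def)
    then obtain t c where tc: "t \<in> carrier R - \<mm>" "c \<in> carrier R" "t \<otimes> a = c \<otimes> b \<or> t \<otimes> b = c \<otimes> a"
      using serial_localization_dvd[OF P.primeideal _ carr] by blast
    have "t \<otimes> a \<in> A" "c \<otimes> a \<in> A" "t \<otimes> b \<in> B" "c \<otimes> b \<in> B"
      using ab tc ideal.I_l_closed[OF A] ideal.I_l_closed[OF B] by auto
    \<comment> \<open>Either equation in \<open>tc(3)\<close> exhibits one element as a multiple of
      both \<open>a\<close> and \<open>b\<close>, so it lies in \<open>A \<inter> B\<close>.\<close>
    then have "t \<otimes> a \<in> Q \<or> t \<otimes> b \<in> Q" using tc(3) AB by (metis IntI subsetD)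
    then show False using cancel[OF tc(1)] carr ab by blast
  qed
  then show ?thesis using idQ by (auto simp: quasi_prime_ideal_def)
qed

text \<open>Write \<open>J\<close> as a finite intersection of primary ideals. A minimal quasi-prime
  \<open>I\<close> above \<open>J\<close> contains one of them, say \<open>Q\<close>. As
  \<open>Q\<close> is itself quasi-prime and contains \<open>J\<close>, minimality gives
  \<open>I = Q\<close>.\<close>

lemma (in cring) finite_minimal_DR:
  assumes "arithmetical R" "laskerian R" and J: "ideal J R" "J \<noteq> carrier R"
  shows "finite (minimal_elements (DR R J))"
proof -
  have "\<exists>F. finite F \<and> F \<noteq> {} \<and> (\<forall>Q\<in>F. primary_ideal Q R) \<and> J = \<Inter>F"
    using assms(2) J by (simp add: laskerian_def)
  then obtain F where F: "finite F" "F \<noteq> {}" "\<And>Q. Q \<in> F \<Longrightarrow> primary_ideal Q R" "J = \<Inter>F"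
    by metis
  have F_ideal: "ideal Q R" if "Q \<in> F" for Q using F(3)[OF that] by (simp add: primary_ideal_def)
  have "minimal_elements (DR R J) \<subseteq> F"
  proof
    fix I assume I: "I \<in> minimal_elements (DR R J)"
    then have qI: "quasi_prime_ideal I R" and "\<Inter>F \<subseteq> I"
      using F(4) by (auto simp: minimal_elements_def DR_def ring_qSpec_def)
    then obtain Q where Q: "Q \<in> F" "Q \<subseteq> I"
      using quasi_prime_ideal_finite_Inter[OF ring_axioms qI F(1,2) F_ideal] by blast
    have "Q \<in> DR R J"
      using Q(1) F(3,4) primary_imp_quasi_prime[OF assms(1)] by (auto simp: DR_def ring_qSpec_def)
    then show "I \<in> F" using I Q by (auto simp: minimal_elements_def)
  qed
  then show ?thesis using F(1) finite_subset by blast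
qed


section \<open>The developed Zariski topology\<close>

context Module.module
begin

section \<open>Closures of points and irreducible closed sets\<close>

lemma qSpecD:
  assumes "L \<in> qSpec R M"
  shows "submodule L R M" "L \<noteq> carrier M" "quasi_prime_ideal (colon R M L) R"
  using assms by (auto simp: qSpec_def)

lemma DM_subset_iff:
  assumes "L \<in> qSpec R M"
  shows "DM R M L \<subseteq> DM R M L' \<longleftrightarrow> colon R M L' \<subseteq> colon R M L"
  using assms by (auto simp: DM_def)

lemma DM_eq_iff:
  assumes "L \<in> qSpec R M" "L' \<in> qSpec R M"
  shows "DM R M L = DM R M L' \<longleftrightarrow> colon R M L = colon R M L'"
  using DM_subset_iff[OF assms(1)] DM_subset_iff[OF assms(2)] by (metis subset_antisym subset_refl)

lemma closure_of_singleton_dev_zariski: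
  assumes L: "L \<in> qSpec R M"
  shows "dev_zariski R M closure_of {L} = DM R M L"
proof (rule closure_of_unique)
  show "{L} \<subseteq> DM R M L" using L by (simp add: DM_def)
  show "closedin (dev_zariski R M) (DM R M L)"
    using qSpecD(1)[OF L] by (auto simp: closedin_dev_zariski)
  fix T assume T: "{L} \<subseteq> T" "closedin (dev_zariski R M) T"
  then obtain N where "T = DM R M N" by (auto simp: closedin_dev_zariski)
  then show "DM R M L \<subseteq> T" using T by (auto simp: DM_def)
qed

text \<open>The set is the closure of a singleton, and singletons are irreducible.\<close>

lemma irreducible_subset_DM:
  assumes L: "L \<in> qSpec R M"
  shows "irreducible_subset (dev_zariski R M) (DM R M L)"
proof -
  have "irreducible_subset (dev_zariski R M) {L}"
    using L by (auto simp: irreducible_subset_iff_closedin topspace_dev_zariski)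
  from irreducible_subset_closure_of[OF this] show ?thesis
    by (simp only: closure_of_singleton_dev_zariski[OF L])
qed

lemma colon_Inter: "F \<noteq> {} \<Longrightarrow> colon R M (\<Inter>F) = (\<Inter>N\<in>F. colon R M N)"
  by (auto simp: colon_def)

text \<open>The defining submodule is the least \<open>N\<close> with \<open>A\<close> contained in
  \<open>(N : M)\<close>. It exists because colons commute with intersections, and any
  \<open>L\<close> satisfying the condition contains it. Thus ideals of \<open>R\<close> also cut
  out closed sets.\<close>

lemma closedin_colon_superset:
  assumes A: "A \<subseteq> carrier R"
  shows "closedin (dev_zariski R M) {L \<in> qSpec R M. A \<subseteq> colon R M L}"
proof -
  define F where "F = {N. submodule N R M \<and> A \<subseteq> colon R M N}"
  have carr: "carrier M \<in> F"
    using A by (auto simp: F_def carrier_is_submodule colon_def)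
  have sub: "submodule (\<Inter>F) R M"
    using carr by (intro submodule_Inter) (auto simp: F_def)
  have "A \<subseteq> colon R M (\<Inter>F)"
    using carr colon_Inter[of F] by (auto simp: F_def)
  moreover have "colon R M (\<Inter>F) \<subseteq> colon R M L" if "L \<in> qSpec R M" "A \<subseteq> colon R M L" for L
    by (rule colon_mono, rule Inter_lower) (use that qSpecD(1) in \<open>simp add: F_def\<close>)
  ultimately have "DM R M (\<Inter>F) = {L \<in> qSpec R M. A \<subseteq> colon R M L}"
    unfolding DM_def by blast
  then show ?thesis using sub unfolding closedin_dev_zariski by metis
qed

lemma closed_irreducible_iff:
  "closedin (dev_zariski R M) Y \<and> irreducible_subset (dev_zariski R M) Y \<longleftrightarrow>
     (\<exists>L\<in>qSpec R M. Y = DM R M L)" (is "?l \<longleftrightarrow> ?r")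
proof
  assume ?r
  then show ?l
    using irreducible_subset_DM qSpecD(1) by (auto simp: closedin_dev_zariski)
next
  assume l: ?l
  then have Y: "Y \<subseteq> qSpec R M" "Y \<noteq> {}"
    and irr: "\<And>C D. closedin (dev_zariski R M) C \<Longrightarrow> closedin (dev_zariski R M) D \<Longrightarrow>
      Y \<subseteq> C \<union> D \<Longrightarrow> Y \<subseteq> C \<or> Y \<subseteq> D"
    by (auto simp: irreducible_subset_iff_closedin topspace_dev_zariski)
  obtain N where N: "Y = DM R M N" using l by (auto simp: closedin_dev_zariski)
  define P where "P = \<Inter>Y"
  have colP: "colon R M P = (\<Inter>L\<in>Y. colon R M L)" unfolding P_def by (rule colon_Inter[OF Y(2)])
  have sub: "submodule P R M"
    unfolding P_def by (rule submodule_Inter) (use Y qSpecD in auto)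
  obtain L where L: "L \<in> Y" using Y(2) by blast
  have "P \<in> qSpec R M"
    unfolding qSpec_def quasi_prime_ideal_def
  proof (intro CollectI conjI allI impI)
    show "submodule P R M" by fact
    show "ideal (colon R M P) R" by (rule ideal_colon[OF sub])
    have "L \<in> qSpec R M" using L Y by blast
    note q = qSpecD[OF this]
    show "P \<noteq> carrier M" using L q(1,2) submoduleE(1) unfolding P_def by blast
    have "colon R M P \<subseteq> colon R M L" using L colP by blast
    moreover have "colon R M L \<subseteq> carrier R" by (auto simp: colon_def)
    ultimately show "colon R M P \<noteq> carrier R"
      using q(3) by (auto simp: quasi_prime_ideal_def)
    fix A B assume AB: "ideal A R \<and> ideal B R \<and> A \<inter> B \<subseteq> colon R M P"
    then have carr: "A \<subseteq> carrier R" "B \<subseteq> carrier R"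
      using ideal.Icarr[of A R] ideal.Icarr[of B R] by auto
    have "Y \<subseteq> {L \<in> qSpec R M. A \<subseteq> colon R M L} \<union> {L \<in> qSpec R M. B \<subseteq> colon R M L}"
    proof
      fix K assume K: "K \<in> Y"
      then have "A \<inter> B \<subseteq> colon R M K" using AB colP by blast
      moreover have KM: "K \<in> qSpec R M" using K Y by blast
      ultimately have "A \<subseteq> colon R M K \<or> B \<subseteq> colon R M K"
        using AB qSpecD(3)[OF KM] unfolding quasi_prime_ideal_def by blast
      then show "K \<in> {L \<in> qSpec R M. A \<subseteq> colon R M L} \<union> {L \<in> qSpec R M. B \<subseteq> colon R M L}"
        using KM by blast
    qed
    from irr[OF closedin_colon_superset[OF carr(1)] closedin_colon_superset[OF carr(2)] this]
    show "A \<subseteq> colon R M P \<or> B \<subseteq> colon R M P"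
      unfolding colP by blast
  qed
  moreover have "Y = DM R M P"
  proof
    show "Y \<subseteq> DM R M P" using Y colP by (auto simp: DM_def)
    \<comment> \<open>Each member of \<open>Y\<close> has a colon containing \<open>(N : M)\<close>,
      and \<open>(P : M)\<close> is the intersection of these colons.\<close>
    have "colon R M N \<subseteq> colon R M P" unfolding colP N DM_def by blast
    then show "DM R M P \<subseteq> Y" unfolding N DM_def by blast
  qed
  ultimately show ?r by blast
qed

section \<open>Generic points and irreducible components\<close>

lemma generic_point_DM:
  assumes "L \<in> qSpec R M"
  shows "generic_point (dev_zariski R M) (DM R M L) L"
  using closure_of_singleton_dev_zariski[OF assms] assms
  by (auto simp: generic_point_def DM_def)

text \<open>Since \<open>DM R M\<close> reverses inclusion of colons, maximal sets
  \<open>D(L)\<close> correspond to minimal colons. Submodules with equal colons yield the same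
  component, so the minimality condition compares colons and not submodules.\<close>

lemma irreducible_components_dev_zariski:
  "irreducible_components (dev_zariski R M) =
     DM R M ` {L \<in> qSpec R M. \<forall>K\<in>qSpec R M. colon R M K \<subseteq> colon R M L \<longrightarrow>
       colon R M K = colon R M L}" (is "_ = ?r")
proof (intro equalityI subsetI)
  fix C assume "C \<in> irreducible_components (dev_zariski R M)"
  then have C: "closedin (dev_zariski R M) C \<and> irreducible_subset (dev_zariski R M) C"
    and max: "\<And>C'. closedin (dev_zariski R M) C' \<and> irreducible_subset (dev_zariski R M) C' \<Longrightarrow>
      C \<subseteq> C' \<Longrightarrow> C' = C"
    by (auto simp: irreducible_components_iff_closedin)
  obtain L where L: "L \<in> qSpec R M" "C = DM R M L" using C closed_irreducible_iff by blast
  have "colon R M K = colon R M L" if K: "K \<in> qSpec R M" "colon R M K \<subseteq> colon R M L" for K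
  proof -
    have "DM R M K = DM R M L"
      using max[of "DM R M K"] K L closed_irreducible_iff DM_subset_iff[OF L(1)] by blast
    then show ?thesis using DM_eq_iff K L by blast
  qed
  then show "C \<in> ?r" using L by blast
next
  fix C assume "C \<in> ?r"
  then obtain L where L: "L \<in> qSpec R M" "C = DM R M L"
    and min: "\<And>K. K \<in> qSpec R M \<Longrightarrow> colon R M K \<subseteq> colon R M L \<Longrightarrow> colon R M K = colon R M L"
    by blast
  have "C' = C" if C': "closedin (dev_zariski R M) C' \<and> irreducible_subset (dev_zariski R M) C'"
    "C \<subseteq> C'" for C'
  proof -
    obtain K where "K \<in> qSpec R M" "C' = DM R M K" using C' closed_irreducible_iff by blast
    then show ?thesis
      using C'(2) L min DM_subset_iff[OF L(1)] DM_eq_iff by metis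
  qed
  then show "C \<in> irreducible_components (dev_zariski R M)"
    unfolding irreducible_components_iff_closedin using L closed_irreducible_iff by metis
qed

text \<open>The natural map depends on \<open>L\<close> only through \<open>(L : M)\<close>. Its
  injectivity therefore makes the colon determine \<open>L\<close>, and minimal colons become
  minimal submodules.\<close>

lemma quasi_prime_embedding_components:
  assumes emb: "quasi_prime_embedding R M"
  shows "inj_on (DM R M) (qSpec R M)"
    "irreducible_components (dev_zariski R M) = DM R M ` minimal_elements (qSpec R M)"
proof -
  have inj: "L = K" if "L \<in> qSpec R M" "K \<in> qSpec R M" "colon R M L = colon R M K" for L K
    using emb that by (auto simp: quasi_prime_embedding_def inj_on_def natural_map_def)
  then show "inj_on (DM R M) (qSpec R M)"
    using DM_eq_iff by (meson inj_onI)
  have "{L \<in> qSpec R M. \<forall>K\<in>qSpec R M. colon R M K \<subseteq> colon R M L \<longrightarrow> colon R M K = colon R M L} =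
      minimal_elements (qSpec R M)" (is "?l = _")
  proof (intro equalityI subsetI)
    fix L assume L: "L \<in> ?l"
    have "K = L" if K: "K \<in> qSpec R M" "K \<subseteq> L" for K
    proof -
      have "colon R M K = colon R M L" using L K(1) colon_mono[OF K(2), of R M] by simp
      then show ?thesis using inj[of K L] L K(1) by simp
    qed
    then show "L \<in> minimal_elements (qSpec R M)"
      using L by (simp add: minimal_elements_def)
  next
    fix L assume "L \<in> minimal_elements (qSpec R M)"
    then have L: "L \<in> qSpec R M" and min: "\<And>K. K \<in> qSpec R M \<Longrightarrow> K \<subseteq> L \<Longrightarrow> K = L"
      by (auto simp: minimal_elements_def)
    have "colon R M K = colon R M L" if K: "K \<in> qSpec R M" "colon R M K \<subseteq> colon R M L" for K
    proof -
      \<comment> \<open>An inclusion of colons does not give \<open>K \<subseteq> L\<close>, so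
        \<open>K\<close> is replaced by \<open>L \<inter> K\<close>. It has the same colon as
        \<open>K\<close>, is again quasi-prime and lies below \<open>L\<close>.\<close>
      have col: "colon R M (L \<inter> K) = colon R M K" using K(2) by (auto simp: colon_Int)
      have "submodule (L \<inter> K) R M"
        using submodule_Inter[of "{L, K}"] qSpecD(1) L K by auto
      moreover have "L \<inter> K \<noteq> carrier M"
        using qSpecD(2)[OF L] submoduleE(1)[OF qSpecD(1)[OF L]] by blast
      ultimately have "L \<inter> K \<in> qSpec R M"
        using qSpecD(3)[OF K(1)] by (simp add: qSpec_def col)
      then have "L \<inter> K = L" using min by blast
      then show ?thesis using col by simp
    qed
    then show "L \<in> ?l" using L by simp
  qed
  then show "irreducible_components (dev_zariski R M) = DM R M ` minimal_elements (qSpec R M)"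
    by (simp only: irreducible_components_dev_zariski)
qed

section \<open>Annihilators and quasi-primeful modules\<close>

lemma submodule_zero: "submodule {\<zero>\<^bsub>M\<^esub>} R M"
  by (rule submoduleI) auto

lemma ideal_annihilator: "ideal (annihilator R M) R"
  unfolding annihilator_def by (rule ideal_colon[OF submodule_zero])

lemma annihilator_subset_colon:
  assumes "submodule N R M"
  shows "annihilator R M \<subseteq> colon R M N"
  unfolding annihilator_def
  by (rule colon_mono) (use subgroup.one_closed[OF submodule.axioms(1)[OF assms]] in simp)

lemma annihilator_eq_carrier_iff:
  "annihilator R M = carrier R \<longleftrightarrow> carrier M = {\<zero>\<^bsub>M\<^esub>}"
proof
  assume "annihilator R M = carrier R"
  then have "\<one> \<in> annihilator R M" by simp
  then show "carrier M = {\<zero>\<^bsub>M\<^esub>}" by (auto simp: annihilator_def colon_def)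
qed (auto simp: annihilator_def colon_def)

lemma colon_in_DR:
  assumes "L \<in> qSpec R M"
  shows "colon R M L \<in> DR R (annihilator R M)"
  using qSpecD[OF assms] annihilator_subset_colon by (auto simp: DR_def ring_qSpec_def)

text \<open>Surjectivity of the natural map gives \<open>L\<close> with the same image as
  \<open>I\<close> modulo the annihilator. Both \<open>I\<close> and \<open>(L : M)\<close> contain
  the annihilator, so the ideal correspondence identifies them.\<close>

lemma quasi_primeful_colon_surj:
  assumes qp: "quasi_primeful R M" and I: "I \<in> DR R (annihilator R M)"
  obtains L where "L \<in> qSpec R M" "colon R M L = I"
proof -
  let ?A = "annihilator R M"
  have qI: "quasi_prime_ideal I R" and AI: "?A \<subseteq> I" using I by (auto simp: DR_def ring_qSpec_def)
  then have idI: "ideal I R" by (simp add: quasi_prime_ideal_def)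
  \<comment> \<open>A proper ideal above the annihilator excludes the zero module, for which
    \<open>quasi_primeful\<close> asserts no surjectivity.\<close>
  have "?A \<noteq> carrier R"
    using qI AI ideal.Icarr[OF idI] unfolding quasi_prime_ideal_def by blast
  then have "natural_map R M ` qSpec R M = ring_qSpec (R Quot ?A)"
    using qp unfolding quasi_primeful_def annihilator_eq_carrier_iff by blast
  moreover have "(+>) ?A ` I \<in> ring_qSpec (R Quot ?A)"
    using R.quasi_prime_ideal_quotient[OF ideal_annihilator qI AI] by (simp add: ring_qSpec_def)
  ultimately have "(+>) ?A ` I \<in> natural_map R M ` qSpec R M" by simp
  then obtain L where L: "L \<in> qSpec R M" "(+>) ?A ` I = (+>) ?A ` colon R M L"
    by (auto simp only: natural_map_def image_iff)
  have "I = colon R M L"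
  proof (rule inj_onD[OF bij_betw_imp_inj_on[OF R.quot_ideal_correspondence[OF ideal_annihilator]]])
    show "(+>) ?A ` I = (+>) ?A ` colon R M L" by (rule L(2))
    show "I \<in> {J. ideal J R \<and> ?A \<subseteq> J}" using idI AI by simp
    show "colon R M L \<in> {J. ideal J R \<and> ?A \<subseteq> J}"
      using qSpecD(1)[OF L(1)] ideal_colon annihilator_subset_colon by simp
  qed
  then show ?thesis using that L by blast
qed

lemma ideal_smult_subset:
  assumes N: "submodule N R M" and I: "I \<subseteq> colon R M N"
  shows "ideal_smult R M I \<subseteq> N"
proof
  fix y assume "y \<in> ideal_smult R M I"
  then obtain n :: nat and a x where y: "y = (\<Oplus>\<^bsub>M\<^esub>k\<in>{..<n}. a k \<odot>\<^bsub>M\<^esub> x k)"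
    and a: "a \<in> {..<n} \<rightarrow> I" and x: "x \<in> {..<n} \<rightarrow> carrier M"
    by (auto simp: ideal_smult_def)
  have NM: "N \<subseteq> carrier M" by (rule submoduleE(1)[OF N])
  have mem: "a k \<odot>\<^bsub>M\<^esub> x k \<in> N" if "k < n" for k
    using that a x I unfolding colon_def by fastforce
  \<comment> \<open>The induction runs over partial sums with \<open>m \<le> n\<close>, because
    \<open>a\<close> and \<open>x\<close> are controlled only below \<open>n\<close>.\<close>
  have "(\<Oplus>\<^bsub>M\<^esub>k\<in>{..<m}. a k \<odot>\<^bsub>M\<^esub> x k) \<in> N" if "m \<le> n" for m
    using that
  proof (induction m)
    case 0
    then show ?case using subgroup.one_closed[OF submodule.axioms(1)[OF N]] by simp
  next
    case (Suc m)
    have "(\<Oplus>\<^bsub>M\<^esub>k\<in>{..<Suc m}. a k \<odot>\<^bsub>M\<^esub> x k) =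
        a m \<odot>\<^bsub>M\<^esub> x m \<oplus>\<^bsub>M\<^esub> (\<Oplus>\<^bsub>M\<^esub>k\<in>{..<m}. a k \<odot>\<^bsub>M\<^esub> x k)"
      unfolding lessThan_Suc using Suc.prems mem NM by (intro M.finsum_insert) (auto simp: Pi_def)
    then show ?case using Suc mem submoduleE(5)[OF N] by simp
  qed
  then show "y \<in> N" unfolding y by blast
qed

lemma subset_colon_ideal_smult:
  assumes "I \<subseteq> carrier R"
  shows "I \<subseteq> colon R M (ideal_smult R M I)"
proof
  fix r assume r: "r \<in> I"
  have "r \<odot>\<^bsub>M\<^esub> x \<in> ideal_smult R M I" if x: "x \<in> carrier M" for x
  proof -
    have "r \<odot>\<^bsub>M\<^esub> x = (\<Oplus>\<^bsub>M\<^esub>k\<in>{..<Suc 0}. r \<odot>\<^bsub>M\<^esub> x)"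
      using r x assms by (subst lessThan_Suc, subst M.finsum_insert) auto
    then show ?thesis
      unfolding ideal_smult_def using r x
      by (intro CollectI exI[of _ "Suc 0"] exI[of _ "\<lambda>_. r"] exI[of _ "\<lambda>_. x"]) auto
  qed
  then show "r \<in> colon R M (ideal_smult R M I)" using r assms by (auto simp: colon_def)
qed

text \<open>With \<open>I = (L : M)\<close>, the inclusion of \<open>IM\<close> in \<open>L\<close>
  bounds \<open>(IM : M)\<close> above by \<open>I\<close>, and \<open>I\<close> always lies in
  \<open>(IM : M)\<close>. The colons agree, and \<open>DM\<close> depends only on the
  colon.\<close>

lemma DM_ideal_smult_colon:
  assumes L: "L \<in> qSpec R M"
  shows "DM R M (ideal_smult R M (colon R M L)) = DM R M L"
proof -
  have "colon R M (ideal_smult R M (colon R M L)) = colon R M L"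
    using colon_mono[OF ideal_smult_subset[OF qSpecD(1)[OF L] subset_refl], of R M]
      subset_colon_ideal_smult[of "colon R M L"] by (auto simp: colon_def)
  then show ?thesis by (simp add: DM_def)
qed

lemma irreducible_components_quasi_primeful:
  assumes qp: "quasi_primeful R M"
  shows "irreducible_components (dev_zariski R M) =
    {DM R M (ideal_smult R M I) | I. I \<in> minimal_elements (DR R (annihilator R M))}"
proof -
  let ?m = "{L \<in> qSpec R M. \<forall>K\<in>qSpec R M. colon R M K \<subseteq> colon R M L \<longrightarrow>
    colon R M K = colon R M L}"
  have "DR R (annihilator R M) = colon R M ` qSpec R M"
  proof (intro equalityI subsetI)
    fix I assume "I \<in> DR R (annihilator R M)"
    from quasi_primeful_colon_surj[OF qp this] show "I \<in> colon R M ` qSpec R M" by auto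
  qed (use colon_in_DR in auto)
  \<comment> \<open>As the colons of quasi-prime submodules are exactly the members of
    \<open>DR R (annihilator R M)\<close>, minimality among colons is minimality in that
    set.\<close>
  then have "minimal_elements (DR R (annihilator R M)) = colon R M ` ?m"
    by (simp only: minimal_elements_def ball_simps) auto
  then have "{DM R M (ideal_smult R M I) | I. I \<in> minimal_elements (DR R (annihilator R M))} =
      (\<lambda>L. DM R M (ideal_smult R M (colon R M L))) ` ?m"
    by (simp only: Setcompr_eq_image Collect_mem_eq image_image)
  also have "\<dots> = DM R M ` ?m"
    by (rule image_cong) (simp_all add: DM_ideal_smult_colon)
  finally show ?thesis by (simp only: irreducible_components_dev_zariski)
qed

end

theorem theorem3p16:
  fixes R :: "('a, 'c) ring_scheme" and M :: "('a, 'b, 'd) module_scheme"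
    and Y :: "'b set set"
  assumes "Module.module R M" and "\<one>\<^bsub>R\<^esub> \<noteq> \<zero>\<^bsub>R\<^esub>" and "Y \<subseteq> qSpec R M"
  shows
    "((closedin (dev_zariski R M) Y \<and> irreducible_subset (dev_zariski R M) Y \<longleftrightarrow>
         (\<exists>L\<in>qSpec R M. Y = DM R M L)) \<and>
      (\<forall>Z. closedin (dev_zariski R M) Z \<and> irreducible_subset (dev_zariski R M) Z \<longrightarrow>
         (\<exists>z. generic_point (dev_zariski R M) Z z))) \<and>
     (quasi_prime_embedding R M \<longrightarrow>
        irreducible_components (dev_zariski R M) \<subseteq> DM R M ` qSpec R M \<and>
        (\<exists>f. (\<forall>L\<in>qSpec R M. f (DM R M L) = L) \<and>
             bij_betw f (irreducible_components (dev_zariski R M))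
                        (minimal_elements (qSpec R M)))) \<and>
     (quasi_primeful R M \<longrightarrow>
        irreducible_components (dev_zariski R M) =
          {DM R M (ideal_smult R M I) | I. I \<in> minimal_elements (DR R (annihilator R M))}) \<and>
     (arithmetical R \<and> laskerian R \<and> carrier M \<noteq> {\<zero>\<^bsub>M\<^esub>} \<and> quasi_primeful R M \<longrightarrow>
        finite (irreducible_components (dev_zariski R M)))"
proof (intro conjI impI allI)
  interpret Module.module R M by fact
  show "closedin (dev_zariski R M) Y \<and> irreducible_subset (dev_zariski R M) Y \<longleftrightarrow>
      (\<exists>L\<in>qSpec R M. Y = DM R M L)"
    by (rule closed_irreducible_iff)
  show "\<exists>z. generic_point (dev_zariski R M) Z z"
    if "closedin (dev_zariski R M) Z \<and> irreducible_subset (dev_zariski R M) Z" for Z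
    using that generic_point_DM unfolding closed_irreducible_iff by blast
  show "irreducible_components (dev_zariski R M) \<subseteq> DM R M ` qSpec R M"
    unfolding irreducible_components_dev_zariski by blast
  show "\<exists>f. (\<forall>L\<in>qSpec R M. f (DM R M L) = L) \<and>
      bij_betw f (irreducible_components (dev_zariski R M)) (minimal_elements (qSpec R M))"
    if emb: "quasi_prime_embedding R M"
  proof -
    note comp = quasi_prime_embedding_components[OF emb]
    \<comment> \<open>Injectivity of \<open>DM R M\<close> makes the assignment of \<open>L\<close>
      to \<open>D(L)\<close> well defined on all quasi-prime submodules, including those that are
      not minimal.\<close>
    define f where "f = inv_into (qSpec R M) (DM R M)"
    have f: "\<forall>L\<in>qSpec R M. f (DM R M L) = L"
      using comp(1) by (simp add: f_def)
    have "minimal_elements (qSpec R M) \<subseteq> qSpec R M" by (auto simp: minimal_elements_def)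
    then have "bij_betw f (irreducible_components (dev_zariski R M)) (minimal_elements (qSpec R M))"
      unfolding comp(2) using f by (intro bij_betw_byWitness[where f' = "DM R M"]) auto
    then show ?thesis using f by blast
  qed
  show comps: "irreducible_components (dev_zariski R M) =
      {DM R M (ideal_smult R M I) | I. I \<in> minimal_elements (DR R (annihilator R M))}"
    if "quasi_primeful R M"
    using that by (rule irreducible_components_quasi_primeful)
  show "finite (irreducible_components (dev_zariski R M))"
    if h: "arithmetical R \<and> laskerian R \<and> carrier M \<noteq> {\<zero>\<^bsub>M\<^esub>} \<and> quasi_primeful R M"
  proof -
    \<comment> \<open>Since \<open>M\<close> is nonzero its annihilator is proper and so has a
      primary decomposition. The components are an image of this finite set.\<close>
    have "finite (minimal_elements (DR R (annihilator R M)))"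
      using h R.finite_minimal_DR[OF _ _ ideal_annihilator] annihilator_eq_carrier_iff by blast
    then show ?thesis using comps h by simp
  qed
qed

end
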